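(* Assume the boundedness condition (constant $\Theta>0$), the existence of the feasible subset $\mathcal{E}$, and the existence of a Slater distribution described in the context. Run the randomized saddle-point algorithm with step sizes $\alpha>0$, $\mu>0$, an arbitrary $P^0\in\mathcal{P}(\mathcal{R})$, $\lambda_1=0$, and an arbitrary sequence of job requests $b^0,b^1,b^2,\ldots\in\mathcal{R}$. Then, for any integer $T>0$ and any integer $1\le K\le T$, the deterministic $K$-benchmark regret $$R^K_T=\sum_{t=1}^T\Big(\mathbb{E}_{P^t}[C_R(A^t)]-\mathbb{E}_{P^K_*}[C_R(A^t)]\Big)$$ of the sequence $\{P^t\}$ generated by the algorithm satisfies $$R^K_T\le\mu(2\Theta+v)^2\frac{(K-1)(2K-1)}{6}+(T-K)\left(\frac12K(4\Theta^2+v^2)\mu+\frac{\Theta^2}{4}\alpha\right)+K(K-1)\Theta+\frac1\alpha.$$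
   Context: **Network model.** There are $N$ servers; server $n$ has $m_n$ resources. $\mathcal{R}_n=\{1,\ldots,m_n\}$, $\mathcal{R}=\prod_{n=1}^N\mathcal{R}_n$. Let $f^R_n,f^V_n,f^T_n$ ($1\le n\le N$) be given positive (nonnegative-valued) functions. For a reservation $a\in\mathcal{R}$ and a job request $b\in\mathcal{R}$, let $\delta_{n,m}=\delta_{n,m}(a,b)$ ($n\ne m$), the number of jobs transferred from server $n$ to server $m$, be a solution of $$\min\sum_{n=1}^N\Big(\sum_{m\ne n}f^T_n(\delta_{n,m})+f^V_n\big(b_n-a_n-\sum_{m\ne n}\delta_{n,m}\big)\Big)\quad\text{s.t. }\delta_{n,m}\le\min\{(b_n-a_n)^+,(a_m-b_m)^+\}\ \forall n\ne m,$$ over nonnegative integers. Costs: reservation cost $C_R(a)=\sum_{n}f^R_n(a_n)$, violation cost $C_V(a,b)=\sum_n f^V_n(b_n-a_n-\sum_{m\neq n}\delta_{n,m})$, transfer cost $C_T(a,b)=\sum_n\sum_{m\ne n}f^T_n(\delta_{n,m})$. A cost threshold $v>0$ is given. **Notation.** $\mathcal{P}(\mathcal{R})=\{P=(p_a)_{a\in\mathcal{R}}\in\mathbb{R}_+^{|\mathcal{R}|}:\sum_a p_a=1\}$. For $P\in\mathcal{P}(\mathcal{R})$ and a function $g$ on $\mathcal{R}$, $\mathbb{E}_P[g(A)]=\sum_{a\in\mathcal{R}}p_a g(a)$ (the superscript on the random reservation $A^t$ inside such an expectation plays no role beyond indexing the time slot). $\|\cdot\|$ is the Euclidean norm on $\mathbb{R}^{|\mathcal{R}|}$,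 and $(x)^+=\max\{0,x\}$. **Assumptions.** (1) There is $\Theta>0$ with $|C_R(a)|\le\Theta$, $|C_T(a,b)|\le\Theta$, $|C_V(a,b)|\le\Theta$ for all $a,b\in\mathcal{R}$. (2) There is a subset $\mathcal{E}\subset\mathcal{P}(\mathcal{R})$ such that for all $P\in\mathcal{E}$, $\mathbb{E}_P[C_V(A,b)+C_T(A,b)]-v\le0$ for all $b\in\mathcal{R}$. (3) There are $\tilde P\in\mathcal{E}$ (a Slater distribution) and $\eta>0$ with $\mathbb{E}_{\tilde P}[C_V(A,b)+C_T(A,b)]-v\le-\eta$ for all $b\in\mathcal{R}$. **Algorithm (randomized saddle-point algorithm).** Given $P^0\in\mathcal{P}(\mathcal{R})$, $b^0\in\mathcal{R}$, $\lambda_1\ge0$, and a job request sequence $(b^t)_{t\ge1}$ in $\mathcal{R}$, for $t=1,2,\ldots$ set $$P^t=\arg\min_{P\in\mathcal{P}(\mathcal{R})}\Big(\tilde{\mathcal{L}}^t(P,\lambda_t)+\frac1{2\alpha}\|P-P^{t-1}\|^2\Big),$$ $$\tilde{\mathcal{L}}^t(P,\lambda)=\mathbb{E}_P[C_R(A)]+\lambda\big(\mathbb{E}_P[C_V(A,b^{t-1})+C_T(A,b^{t-1})]-v\big),$$ $$\lambda_{t+1}=\Big(\lambda_t+\mu\big(\mathbb{E}_{P^t}[C_V(A^t,b^{t-1})+C_T(A^t,b^{t-1})]-v\big)\Big)^+.$$ **Benchmark.** For $1\le K\le T$, $P^K_*\in\mathcal{P}(\mathcal{R})$ is an optimal solution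 (with $b^1,\ldots,b^T$ known in advance) of $$\min_{P\in\mathcal{P}(\mathcal{R})}\sum_{t=1}^T\mathbb{E}_P[C_R(A^t)]\quad\text{s.t. }\sum_{k=t}^{t+K-1}\mathbb{E}_P[C_V(A^k,b^k)+C_T(A^k,b^k)]\le Kv\quad\forall t=1,\ldots,T-K+1.$$ *)

theory Defs
  imports "HOL-Analysis.L2_Norm" "HOL-Library.FuncSet"
begin

type_synonym reservation = "nat \<Rightarrow> nat"

text \<open>
  Servers are numbered \<open>1, ..., servers S\<close>. The violation cost functions take integer
  arguments, since the number of violating jobs \<open>b\<^sub>n - a\<^sub>n - \<Sum>\<^sub>m \<delta>\<^sub>n\<^sub>m\<close> may be negative.
  The field \<open>transfers\<close> is the chosen solution \<open>\<delta>(a, b)\<close> of the transfer problem.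
\<close>

record network =
  servers :: nat
  resources :: "nat \<Rightarrow> nat"
  res_fun :: "nat \<Rightarrow> nat \<Rightarrow> real"
  viol_fun :: "nat \<Rightarrow> int \<Rightarrow> real"
  trans_fun :: "nat \<Rightarrow> nat \<Rightarrow> real"
  transfers :: "reservation \<Rightarrow> reservation \<Rightarrow> nat \<Rightarrow> nat \<Rightarrow> nat"
  threshold :: real

definition reservations :: "network \<Rightarrow> reservation set" where
  "reservations S = (\<Pi>\<^sub>E n\<in>{1..servers S}. {1..resources S n})"

text \<open>The diagonal of a transfer plan \<open>d\<close> is never used.\<close>

definition violating_jobs ::
  "network \<Rightarrow> reservation \<Rightarrow> reservation \<Rightarrow> (nat \<Rightarrow> nat \<Rightarrow> nat) \<Rightarrow> nat \<Rightarrow> int" where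
  "violating_jobs S a b d n =
     int (b n) - int (a n) - (\<Sum>m\<in>{1..servers S} - {n}. int (d n m))"

definition plan_violation_cost ::
  "network \<Rightarrow> reservation \<Rightarrow> reservation \<Rightarrow> (nat \<Rightarrow> nat \<Rightarrow> nat) \<Rightarrow> real" where
  "plan_violation_cost S a b d = (\<Sum>n\<in>{1..servers S}. viol_fun S n (violating_jobs S a b d n))"

definition plan_transfer_cost :: "network \<Rightarrow> (nat \<Rightarrow> nat \<Rightarrow> nat) \<Rightarrow> real" where
  "plan_transfer_cost S d =
     (\<Sum>n\<in>{1..servers S}. \<Sum>m\<in>{1..servers S} - {n}. trans_fun S n (d n m))"

definition admissible_plan ::
  "network \<Rightarrow> reservation \<Rightarrow> reservation \<Rightarrow> (nat \<Rightarrow> nat \<Rightarrow> nat) \<Rightarrow> bool" where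
  "admissible_plan S a b d \<longleftrightarrow>
     (\<forall>n\<in>{1..servers S}. \<forall>m\<in>{1..servers S} - {n}.
        int (d n m) \<le> min (max 0 (int (b n) - int (a n))) (max 0 (int (a m) - int (b m))))"

definition optimal_plan ::
  "network \<Rightarrow> reservation \<Rightarrow> reservation \<Rightarrow> (nat \<Rightarrow> nat \<Rightarrow> nat) \<Rightarrow> bool" where
  "optimal_plan S a b d \<longleftrightarrow>
     is_arg_min (\<lambda>d. plan_transfer_cost S d + plan_violation_cost S a b d)
       (admissible_plan S a b) d"

definition network_model :: "network \<Rightarrow> bool" where
  "network_model S \<longleftrightarrow>
     1 \<le> servers S \<and>
     (\<forall>n\<in>{1..servers S}. 1 \<le> resources S n) \<and>
     (\<forall>n\<in>{1..servers S}. (\<forall>x. 0 \<le> res_fun S n x) \<and> (\<forall>x. 0 \<le> viol_fun S n x) \<and>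
        (\<forall>x. 0 \<le> trans_fun S n x)) \<and>
     (\<forall>a\<in>reservations S. \<forall>b\<in>reservations S. optimal_plan S a b (transfers S a b)) \<and>
     0 < threshold S"

definition reservation_cost :: "network \<Rightarrow> reservation \<Rightarrow> real" where
  "reservation_cost S a = (\<Sum>n\<in>{1..servers S}. res_fun S n (a n))"

definition violation_cost :: "network \<Rightarrow> reservation \<Rightarrow> reservation \<Rightarrow> real" where
  "violation_cost S a b = plan_violation_cost S a b (transfers S a b)"

definition transfer_cost :: "network \<Rightarrow> reservation \<Rightarrow> reservation \<Rightarrow> real" where
  "transfer_cost S a b = plan_transfer_cost S (transfers S a b)"

text \<open>
  Distributions are extensional (\<open>undefined\<close> off \<open>reservations S\<close>), so that they correspond
  one-to-one to vectors indexed by reservations.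
\<close>

definition distributions :: "network \<Rightarrow> (reservation \<Rightarrow> real) set" where
  "distributions S = {P \<in> reservations S \<rightarrow>\<^sub>E {0..}. (\<Sum>a\<in>reservations S. P a) = 1}"

definition expect :: "network \<Rightarrow> (reservation \<Rightarrow> real) \<Rightarrow> (reservation \<Rightarrow> real) \<Rightarrow> real" where
  "expect S P g = (\<Sum>a\<in>reservations S. P a * g a)"

definition expected_load_cost :: "network \<Rightarrow> (reservation \<Rightarrow> real) \<Rightarrow> reservation \<Rightarrow> real" where
  "expected_load_cost S P b = expect S P (\<lambda>a. violation_cost S a b + transfer_cost S a b)"

definition lagrangian ::
  "network \<Rightarrow> reservation \<Rightarrow> (reservation \<Rightarrow> real) \<Rightarrow> real \<Rightarrow> real" where
  "lagrangian S b P l =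
     expect S P (reservation_cost S) + l * (expected_load_cost S P b - threshold S)"

text \<open>
  \<open>P t\<close>, \<open>lam t\<close> and \<open>b t\<close> are \<open>P\<^sup>t\<close>, \<open>\<lambda>\<^sub>t\<close> and \<open>b\<^sup>t\<close>; the value \<open>lam 0\<close> is never used.
  \<open>L2_set\<close> over the reservations is the Euclidean norm.
\<close>

definition saddle_point_run ::
  "network \<Rightarrow> real \<Rightarrow> real \<Rightarrow> (nat \<Rightarrow> reservation) \<Rightarrow>
     (nat \<Rightarrow> reservation \<Rightarrow> real) \<Rightarrow> (nat \<Rightarrow> real) \<Rightarrow> bool" where
  "saddle_point_run S \<alpha> \<mu> b P lam \<longleftrightarrow>
     (\<forall>t. b t \<in> reservations S) \<and> P 0 \<in> distributions S \<and> 0 \<le> lam 1 \<and>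
     (\<forall>t\<ge>1.
        is_arg_min
          (\<lambda>Q. lagrangian S (b (t - 1)) Q (lam t)
             + 1 / (2 * \<alpha>) * (L2_set (\<lambda>a. Q a - P (t - 1) a) (reservations S))\<^sup>2)
          (\<lambda>Q. Q \<in> distributions S) (P t) \<and>
        lam (t + 1) =
          max 0 (lam t + \<mu> * (expected_load_cost S (P t) (b (t - 1)) - threshold S)))"

definition benchmark_feasible ::
  "network \<Rightarrow> (nat \<Rightarrow> reservation) \<Rightarrow> nat \<Rightarrow> nat \<Rightarrow> (reservation \<Rightarrow> real) \<Rightarrow> bool" where
  "benchmark_feasible S b K T P \<longleftrightarrow>
     P \<in> distributions S \<and>
     (\<forall>t\<in>{1..T - K + 1}.
        (\<Sum>k = t..t + K - 1. expected_load_cost S P (b k)) \<le> real K * threshold S)"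

definition benchmark_optimal ::
  "network \<Rightarrow> (nat \<Rightarrow> reservation) \<Rightarrow> nat \<Rightarrow> nat \<Rightarrow> (reservation \<Rightarrow> real) \<Rightarrow> bool" where
  "benchmark_optimal S b K T P \<longleftrightarrow>
     is_arg_min (\<lambda>Q. \<Sum>t = 1..T. expect S Q (reservation_cost S)) (benchmark_feasible S b K T) P"

definition regret ::
  "network \<Rightarrow> nat \<Rightarrow> (nat \<Rightarrow> reservation \<Rightarrow> real) \<Rightarrow> (reservation \<Rightarrow> real) \<Rightarrow> real" where
  "regret S T P Pstar =
     (\<Sum>t = 1..T. expect S (P t) (reservation_cost S) - expect S Pstar (reservation_cost S))"

end

theory Submission
  imports Defs
begin

text \<open>
  The proof combines a drift analysis of the multiplier with a proximal-step analysis of the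
  distributions, and treats the window constraints of the benchmark by comparing the multiplier
  inside a window with its value at the start of the window.

  Let \<open>v = threshold S\<close>. Write \<open>g\<^sub>t(Q)\<close> for the constraint value \<open>expected_load_cost S Q (b (t - 1)) - v\<close> and
  \<open>U = max 0 (2 * \<Theta> - v)\<close>, so that \<open>- v \<le> g\<^sub>t(Q) \<le> U\<close>. Strong convexity of the proximal
  objective (\<open>proximal_step\<close>) gives, for the per-slot regret \<open>r\<^sub>t\<close> against the benchmark \<open>P\<^sub>*\<close>,
  \<open>r\<^sub>t \<le> \<lambda>\<^sub>t g\<^sub>t(P\<^sub>*) - \<lambda>\<^sub>t g\<^sub>t(P\<^sup>t) + (\<parallel>P\<^sub>* - P\<^sup>t\<^sup>-\<^sup>1\<parallel>\<^sup>2 - \<parallel>P\<^sub>* - P\<^sup>t\<parallel>\<^sup>2) / (2\<alpha>)\<close>.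
  The last part telescopes to at most \<open>1 / \<alpha>\<close>, because the simplex has squared diameter at most \<open>2\<close>.

  The terms \<open>- \<lambda>\<^sub>t g\<^sub>t(P\<^sup>t)\<close> are controlled by the potential \<open>\<lambda>\<^sub>t\<^sup>2 / (2\<mu>)\<close>
  (\<open>multiplier_potential\<close>, \<open>multiplier_correlation\<close>). The first and the last slot together cost
  only \<open>\<mu> (U\<^sup>2 + v\<^sup>2) / 2\<close>, since the multiplier leaves \<open>0\<close> only by an upward move (at most \<open>\<mu> U\<close>)
  and a positive last term needs a negative constraint value (at least \<open>- v\<close>). This is why \<open>n + 1\<close>
  slots cost only \<open>n\<close> units.

  The terms \<open>\<lambda>\<^sub>t g\<^sub>t(P\<^sub>*)\<close> have no sign individually, but \<open>g\<^sub>t(P\<^sub>*)\<close> sums to at most \<open>0\<close> over every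
  window of \<open>K\<close> slots, and the nonnegative multiplier moves by at most \<open>\<mu> M\<close> per slot, where
  \<open>M = max U v\<close>. Cutting the horizon into windows from the right leaves an incomplete window only at
  the start, where the multiplier is still small (\<open>windowed_correlation\<close>).

  These bounds are applied to the first \<open>T - K + 1\<close> slots; each of the other \<open>K - 1\<close> slots costs at
  most \<open>\<Theta>\<close>. The result is
  \<open>\<mu> M\<^sup>2 (T - K + 1) (K - 1) / 2 + \<mu> (U\<^sup>2 + v\<^sup>2) (T - K) / 2 + (K - 1) \<Theta> + 1 / \<alpha>\<close>, which is at most
  the claimed bound because \<open>M\<^sup>2 \<le> U\<^sup>2 + v\<^sup>2 \<le> 4\<Theta>\<^sup>2 + v\<^sup>2 \<le> (2\<Theta> + v)\<^sup>2\<close> and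
  \<open>3 (K - 1) \<le> (2K - 1) (K - 1)\<close>.
\<close>

section \<open>Proximal steps on the simplex of distributions\<close>

lemma finite_reservations: "finite (reservations S)"
  unfolding reservations_def by (rule finite_PiE) auto

lemma distributionsD:
  assumes "Q \<in> distributions S"
  shows "(\<Sum>a\<in>reservations S. Q a) = 1"
    and "\<And>a. a \<in> reservations S \<Longrightarrow> 0 \<le> Q a"
    and "\<And>a. a \<in> reservations S \<Longrightarrow> Q a \<le> 1"
proof -
  show one: "(\<Sum>a\<in>reservations S. Q a) = 1"
    using assms by (simp add: distributions_def)
  show nonneg: "0 \<le> Q a" if "a \<in> reservations S" for a
    using assms that by (auto simp: distributions_def PiE_def Pi_def)
  show "Q a \<le> 1" if "a \<in> reservations S" for a
    using member_le_sum[of a "reservations S" Q] that nonneg one finite_reservations[of S] by simp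
qed

lemma distributions_segment:
  assumes P: "P \<in> distributions S" and Q: "Q \<in> distributions S" and \<theta>: "0 \<le> \<theta>" "\<theta> \<le> 1"
  shows "(\<lambda>a\<in>reservations S. P a + \<theta> * (Q a - P a)) \<in> distributions S"
proof -
  have "0 \<le> P a + \<theta> * (Q a - P a)" if a: "a \<in> reservations S" for a
  proof -
    have "0 \<le> (1 - \<theta>) * P a + \<theta> * Q a"
      using distributionsD(2)[OF P a] distributionsD(2)[OF Q a] \<theta> by simp
    then show ?thesis by (simp add: algebra_simps)
  qed
  moreover have "(\<Sum>a\<in>reservations S. P a + \<theta> * (Q a - P a)) = 1"
    using distributionsD(1)[OF P] distributionsD(1)[OF Q]
    by (simp add: sum.distrib sum_subtractf flip: sum_distrib_left)
  ultimately show ?thesis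
    by (auto simp: distributions_def)
qed

lemma expect_between:
  assumes Q: "Q \<in> distributions S"
    and g: "\<And>a. a \<in> reservations S \<Longrightarrow> l \<le> g a" "\<And>a. a \<in> reservations S \<Longrightarrow> g a \<le> u"
  shows "l \<le> expect S Q g" and "expect S Q g \<le> u"
proof -
  have const: "(\<Sum>a\<in>reservations S. Q a * c) = c" for c
    using distributionsD(1)[OF Q] by (simp flip: sum_distrib_right)
  have "(\<Sum>a\<in>reservations S. Q a * l) \<le> expect S Q g"
    unfolding expect_def by (intro sum_mono mult_left_mono g distributionsD(2)[OF Q])
  then show "l \<le> expect S Q g" by (simp add: const)
  have "expect S Q g \<le> (\<Sum>a\<in>reservations S. Q a * u)"
    unfolding expect_def by (intro sum_mono mult_left_mono g distributionsD(2)[OF Q])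
  then show "expect S Q g \<le> u" by (simp add: const)
qed

lemma L2_set_power2: "(L2_set f A)\<^sup>2 = (\<Sum>a\<in>A. (f a)\<^sup>2)"
  by (simp add: L2_set_def sum_nonneg)

text \<open>
  Entries \<open>p\<close>, \<open>q\<close> in \<open>[0, 1]\<close> satisfy \<open>(p - q)\<^sup>2 \<le> p\<^sup>2 + q\<^sup>2 \<le> p + q\<close>, and each distribution sums
  to \<open>1\<close>.
\<close>

lemma distributions_diameter:
  assumes P: "P \<in> distributions S" and Q: "Q \<in> distributions S"
  shows "(L2_set (\<lambda>a. P a - Q a) (reservations S))\<^sup>2 \<le> 2"
proof -
  have "(P a - Q a)\<^sup>2 \<le> P a + Q a" if a: "a \<in> reservations S" for a
  proof -
    note p = distributionsD(2,3)[OF P a] and q = distributionsD(2,3)[OF Q a]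
    have "0 \<le> P a * Q a" "P a * P a \<le> P a" "Q a * Q a \<le> Q a"
      using p q by (auto intro: mult_left_le)
    then show ?thesis by (simp add: power2_eq_square algebra_simps)
  qed
  then have "(L2_set (\<lambda>a. P a - Q a) (reservations S))\<^sup>2 \<le> (\<Sum>a\<in>reservations S. P a + Q a)"
    unfolding L2_set_power2 by (rule sum_mono)
  then show ?thesis
    using distributionsD(1)[OF P] distributionsD(1)[OF Q] by (simp add: sum.distrib)
qed

lemma nonneg_if_nonneg_perturbed:
  fixes x y :: real
  assumes "\<And>\<theta>. 0 < \<theta> \<Longrightarrow> \<theta> \<le> 1 \<Longrightarrow> 0 \<le> x + \<theta> * y"
  shows "0 \<le> x"
proof (rule ccontr)
  assume x: "\<not> 0 \<le> x"
  define \<theta> where "\<theta> = - x / (\<bar>y\<bar> - x + 1)"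
  have "0 < \<theta>" "\<theta> \<le> 1" using x by (auto simp: \<theta>_def field_simps)
  moreover have "\<theta> * y < - x"
  proof -
    have "- x * y < - x * (\<bar>y\<bar> - x + 1)" using x by (intro mult_strict_left_mono) auto
    moreover have "0 < \<bar>y\<bar> - x + 1" using x by auto
    moreover have "\<theta> * y = - x * y / (\<bar>y\<bar> - x + 1)" by (simp add: \<theta>_def)
    ultimately show ?thesis by (metis pos_divide_less_eq)
  qed
  ultimately show False using assms[of \<theta>] by linarith
qed

text \<open>
  A minimiser \<open>P\<close> of a linear function plus \<open>\<kappa>\<close> times the squared distance to \<open>Z\<close> beats every
  competitor \<open>Q\<close> by the margin \<open>\<kappa> \<parallel>Q - P\<parallel>\<^sup>2\<close>: moving from \<open>P\<close> a little towards \<open>Q\<close> does not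
  decrease the objective, so the directional derivative at \<open>P\<close> is nonnegative, and the objective
  exceeds its linearisation by exactly this margin.
\<close>

lemma proximal_step:
  assumes P: "is_arg_min
        (\<lambda>Q. expect S Q c + d + \<kappa> * (L2_set (\<lambda>a. Q a - Z a) (reservations S))\<^sup>2)
        (\<lambda>Q. Q \<in> distributions S) P"
    and Q: "Q \<in> distributions S"
  shows "expect S P c + \<kappa> * (L2_set (\<lambda>a. P a - Z a) (reservations S))\<^sup>2
        + \<kappa> * (L2_set (\<lambda>a. Q a - P a) (reservations S))\<^sup>2
      \<le> expect S Q c + \<kappa> * (L2_set (\<lambda>a. Q a - Z a) (reservations S))\<^sup>2"
proof -
  let ?A = "reservations S"
  let ?n = "\<lambda>Q Z. (\<Sum>a\<in>?A. (Q a - Z a)\<^sup>2)"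
  let ?ip = "\<Sum>a\<in>?A. (P a - Z a) * (Q a - P a)"
  have Pd: "P \<in> distributions S"
    using P by (simp add: is_arg_min_def)
  have min: "expect S P c + \<kappa> * ?n P Z \<le> expect S R c + \<kappa> * ?n R Z"
      if "R \<in> distributions S" for R
    using P that by (fastforce simp: is_arg_min_linorder L2_set_power2)
  have "0 \<le> (expect S Q c - expect S P c + 2 * \<kappa> * ?ip) + \<theta> * (\<kappa> * ?n Q P)"
    if \<theta>: "0 < \<theta>" "\<theta> \<le> 1" for \<theta>
  proof -
    define R where "R = (\<lambda>a\<in>?A. P a + \<theta> * (Q a - P a))"
    have "R \<in> distributions S"
      unfolding R_def using \<theta> by (intro distributions_segment[OF Pd Q]) auto
    note le = min[OF this]
    have eR: "expect S R c = expect S P c + \<theta> * (expect S Q c - expect S P c)"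
      unfolding expect_def sum_subtractf[symmetric] sum_distrib_left sum.distrib[symmetric]
      by (rule sum.cong) (auto simp: R_def algebra_simps)
    have nR: "?n R Z = ?n P Z + 2 * \<theta> * ?ip + \<theta>\<^sup>2 * ?n Q P"
      unfolding sum_distrib_left sum.distrib[symmetric]
      by (rule sum.cong) (auto simp: R_def power2_eq_square algebra_simps)
    have "0 \<le> \<theta> * ((expect S Q c - expect S P c + 2 * \<kappa> * ?ip) + \<theta> * (\<kappa> * ?n Q P))"
      using le unfolding eR nR by (simp add: power2_eq_square algebra_simps)
    then show ?thesis using \<theta> by (simp add: zero_le_mult_iff)
  qed
  then have dir: "0 \<le> expect S Q c - expect S P c + 2 * \<kappa> * ?ip"
    by (rule nonneg_if_nonneg_perturbed)
  have "?n Q Z = ?n P Z + 2 * ?ip + ?n Q P"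
    unfolding sum_distrib_left sum.distrib[symmetric]
    by (rule sum.cong) (auto simp: power2_eq_square algebra_simps)
  then have "\<kappa> * ?n Q Z = \<kappa> * ?n P Z + 2 * \<kappa> * ?ip + \<kappa> * ?n Q P"
    by (simp add: algebra_simps)
  with dir show ?thesis by (simp add: L2_set_power2)
qed

section \<open>Drift of the multiplier\<close>

lemma multiplier_nonneg:
  fixes l g :: "nat \<Rightarrow> real"
  assumes "l 1 = 0" and "\<And>t. 1 \<le> t \<Longrightarrow> l (t + 1) = max 0 (l t + \<mu> * g t)" and "1 \<le> t"
  shows "0 \<le> l t"
proof (cases "t = 1")
  case False
  with assms(3) have "l t = max 0 (l (t - 1) + \<mu> * g (t - 1))"
    using assms(2)[of "t - 1"] by simp
  then show ?thesis by simp
qed (use assms(1) in simp)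

lemma multiplier_step:
  fixes l g :: "nat \<Rightarrow> real"
  assumes rec: "l (t + 1) = max 0 (l t + \<mu> * g t)" and "0 \<le> l t" "0 \<le> \<mu>" "\<bar>g t\<bar> \<le> M"
  shows "\<bar>l (t + 1) - l t\<bar> \<le> \<mu> * M"
proof -
  have "\<bar>\<mu> * g t\<bar> \<le> \<mu> * M"
    using assms by (simp add: abs_mult mult_left_mono)
  then show ?thesis using assms(2) unfolding rec by linarith
qed

text \<open>
  Adding the potential to the sum absorbs every cross term \<open>\<lambda>\<^sub>t g\<^sub>t\<close>, because
  \<open>\<lambda>\<^sub>t\<^sub>+\<^sub>1\<^sup>2 \<le> (\<lambda>\<^sub>t + \<mu> g\<^sub>t)\<^sup>2\<close>. The first slot contributes only \<open>\<mu> U\<^sup>2 / 2\<close>, as the step from \<open>0\<close> can only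
  lead upwards.
\<close>

lemma multiplier_potential:
  fixes l g :: "nat \<Rightarrow> real"
  assumes l1: "l 1 = 0" and rec: "\<And>t. 1 \<le> t \<Longrightarrow> l (t + 1) = max 0 (l t + \<mu> * g t)"
    and \<mu>: "0 < \<mu>" and g: "\<And>t. 1 \<le> t \<Longrightarrow> - v \<le> g t" "\<And>t. 1 \<le> t \<Longrightarrow> g t \<le> U"
    and U: "0 \<le> U" and v: "0 \<le> v"
  shows "(\<Sum>t = 1..n + 1. - l t * g t) + (l (n + 2))\<^sup>2 / (2 * \<mu>)
      \<le> real n * (\<mu> * (U\<^sup>2 + v\<^sup>2) / 2) + \<mu> * U\<^sup>2 / 2"
proof (induction n)
  case 0
  have "l 2 = max 0 (\<mu> * g 1)" using rec[of 1] l1 by (simp add: numeral_2_eq_2)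
  also have "\<dots> \<le> \<mu> * U" using g(2)[of 1] \<mu> U by simp
  finally have "l 2 \<le> \<mu> * U" .
  moreover have "0 \<le> l 2" using multiplier_nonneg[OF l1 rec] by simp
  ultimately have "(l 2)\<^sup>2 \<le> (\<mu> * U)\<^sup>2" by (rule power_mono)
  then show ?case using \<mu> l1 by (simp add: field_simps power2_eq_square numeral_2_eq_2)
next
  case (Suc n)
  let ?t = "n + 2"
  have "(l (?t + 1))\<^sup>2 \<le> (l ?t + \<mu> * g ?t)\<^sup>2"
    using rec[of ?t] by (cases "0 \<le> l ?t + \<mu> * g ?t") auto
  also have "\<dots> = (l ?t)\<^sup>2 + 2 * \<mu> * (l ?t * g ?t) + \<mu>\<^sup>2 * (g ?t)\<^sup>2"
    by (simp add: power2_eq_square algebra_simps)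
  finally have pot: "(l (?t + 1))\<^sup>2 / (2 * \<mu>) \<le> (l ?t)\<^sup>2 / (2 * \<mu>) + l ?t * g ?t + \<mu> * (g ?t)\<^sup>2 / 2"
    using \<mu> by (simp add: field_simps power2_eq_square)
  have "(g ?t)\<^sup>2 \<le> U\<^sup>2 + v\<^sup>2"
  proof (cases "0 \<le> g ?t")
    case True
    then have "(g ?t)\<^sup>2 \<le> U\<^sup>2" using g(2)[of ?t] by (intro power_mono) auto
    then show ?thesis by (simp add: add_increasing2)
  next
    case False
    then have "(- g ?t)\<^sup>2 \<le> v\<^sup>2" using g(1)[of ?t] by (intro power_mono) auto
    then show ?thesis by (simp add: add_increasing)
  qed
  then have sq: "\<mu> * (g ?t)\<^sup>2 / 2 \<le> \<mu> * (U\<^sup>2 + v\<^sup>2) / 2" using \<mu> by simp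
  have sum: "(\<Sum>t = 1..Suc n + 1. - l t * g t) = (\<Sum>t = 1..n + 1. - l t * g t) - l ?t * g ?t"
    by simp
  have unit: "real (Suc n) * C = real n * C + C" for C :: real by (simp add: algebra_simps)
  have "(\<Sum>t = 1..Suc n + 1. - l t * g t) + (l (?t + 1))\<^sup>2 / (2 * \<mu>)
      \<le> real (Suc n) * (\<mu> * (U\<^sup>2 + v\<^sup>2) / 2) + \<mu> * U\<^sup>2 / 2"
    using pot sq sum Suc.IH unfolding unit by linarith
  then show ?case by simp
qed

text \<open>
  The last slot is not charged to the potential it creates but to the one it finds: by the
  arithmetic-geometric mean inequality
  \<open>- \<lambda> g \<le> \<lambda> v \<le> \<lambda>\<^sup>2 / (2\<mu>) + \<mu> v\<^sup>2 / 2\<close>. Together with the cheap first slot this saves one unit.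
\<close>

lemma multiplier_correlation:
  fixes l g :: "nat \<Rightarrow> real"
  assumes l1: "l 1 = 0" and rec: "\<And>t. 1 \<le> t \<Longrightarrow> l (t + 1) = max 0 (l t + \<mu> * g t)"
    and \<mu>: "0 < \<mu>" and g: "\<And>t. 1 \<le> t \<Longrightarrow> - v \<le> g t" "\<And>t. 1 \<le> t \<Longrightarrow> g t \<le> U"
    and U: "0 \<le> U" and v: "0 \<le> v"
  shows "(\<Sum>t = 1..n + 1. - l t * g t) \<le> real n * (\<mu> * (U\<^sup>2 + v\<^sup>2) / 2)"
proof (cases n)
  case 0
  then show ?thesis using l1 by simp
next
  case (Suc k)
  let ?t = "k + 2"
  note pot = multiplier_potential[where n = k, OF l1 rec \<mu> g U v]
  have "l ?t * (- g ?t) \<le> l ?t * v"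
    using g(1)[of ?t] multiplier_nonneg[where t = ?t, OF l1 rec] by (intro mult_left_mono) auto
  also have "l ?t * v \<le> (l ?t)\<^sup>2 / (2 * \<mu>) + \<mu> * v\<^sup>2 / 2"
  proof -
    have "0 \<le> (l ?t - \<mu> * v)\<^sup>2 / (2 * \<mu>)" using \<mu> by simp
    also have "\<dots> = (l ?t)\<^sup>2 / (2 * \<mu>) + \<mu> * v\<^sup>2 / 2 - l ?t * v"
      using \<mu> by (simp add: field_simps power2_eq_square)
    finally show ?thesis by simp
  qed
  finally show ?thesis using pot Suc by (simp add: algebra_simps add_divide_distrib)
qed

section \<open>Window constraints\<close>

lemma drift_from_start:
  fixes l :: "nat \<Rightarrow> real"
  assumes "\<And>t. 1 \<le> t \<Longrightarrow> \<bar>l (t + 1) - l t\<bar> \<le> D" and "1 \<le> t"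
  shows "\<bar>l (t + k) - l t\<bar> \<le> real k * D"
proof (induction k)
  case (Suc k)
  have "\<bar>l (t + k + 1) - l (t + k)\<bar> \<le> D" using assms by simp
  with Suc.IH show ?case by (simp add: algebra_simps)
qed simp

text \<open>
  The offset \<open>i\<close> is \<open>0\<close> for a window compared with its own first multiplier, and \<open>1\<close> for the
  incomplete window at the start, which begins one slot after the multiplier was \<open>0\<close>.
\<close>

lemma weighted_drift_bound:
  fixes l h :: "nat \<Rightarrow> real"
  assumes drift: "\<And>k. k < m \<Longrightarrow> \<bar>l k - c\<bar> \<le> real (k + i) * D"
    and h: "\<And>k. k < m \<Longrightarrow> \<bar>h k\<bar> \<le> M"
  shows "(\<Sum>k<m. l k * h k) \<le> c * (\<Sum>k<m. h k) + D * M * (\<Sum>k<m. real (k + i))"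
proof -
  have "(l k - c) * h k \<le> real (k + i) * D * M" if "k < m" for k
  proof -
    have "(l k - c) * h k \<le> \<bar>l k - c\<bar> * \<bar>h k\<bar>" by (metis abs_ge_self abs_mult)
    also have "\<dots> \<le> real (k + i) * D * M"
      using drift[OF that] h[OF that] by (intro mult_mono) auto
    finally show ?thesis .
  qed
  then have "(\<Sum>k<m. (l k - c) * h k) \<le> (\<Sum>k<m. real (k + i) * D * M)"
    by (intro sum_mono) auto
  then show ?thesis
    by (simp add: algebra_simps sum_subtractf sum_distrib_left)
qed

text \<open>
  Peeling off windows from the right costs \<open>D M K (K - 1) / 2\<close> per window: against the multiplier
  fixed at the start of the window the sum is nonpositive, and the multiplier drifts by at most
  \<open>k D\<close> after \<open>k\<close> slots. What remains at the left has \<open>n < K\<close> slots, where the multiplier has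
  drifted from \<open>0\<close> for at most \<open>s\<close> slots at time \<open>s + 1\<close>, and costs \<open>D M n (n + 1) / 2\<close>.
\<close>

lemma windowed_correlation:
  fixes l h :: "nat \<Rightarrow> real"
  assumes l1: "l 1 = 0" and l0: "\<And>t. 1 \<le> t \<Longrightarrow> 0 \<le> l t"
    and drift: "\<And>t. 1 \<le> t \<Longrightarrow> \<bar>l (t + 1) - l t\<bar> \<le> D"
    and h: "\<And>t. 1 \<le> t \<Longrightarrow> \<bar>h t\<bar> \<le> M" and D: "0 \<le> D" and M: "0 \<le> M" and K: "1 \<le> K"
    and window: "\<And>t. 1 \<le> t \<Longrightarrow> t + K \<le> n + 1 \<Longrightarrow> (\<Sum>k<K. h (t + k)) \<le> 0"
  shows "(\<Sum>s<n. l (s + 2) * h (s + 1)) \<le> D * M / 2 * (real (n + 1) * (real K - 1))"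
  using window
proof (induction n rule: less_induct)
  case (less n)
  have gauss: "(\<Sum>k<m. real k) = real m * (real m - 1) / 2" for m
    by (induction m) (auto simp: field_simps)
  show ?case
  proof (cases "n < K")
    case True
    have "(\<Sum>s<n. l (s + 2) * h (s + 1))
        \<le> 0 * (\<Sum>s<n. h (s + 1)) + D * M * (\<Sum>s<n. real (s + 1))"
    proof (rule weighted_drift_bound)
      show "\<bar>l (s + 2) - 0\<bar> \<le> real (s + 1) * D" for s
        using drift_from_start[where l = l, OF drift, of 1 "s + 1"] l1 by simp
    qed (simp add: h)
    also have "\<dots> = D * M / 2 * (real (n + 1) * real n)"
      by (simp add: sum.distrib gauss) (simp add: field_simps)
    also have "\<dots> \<le> D * M / 2 * (real (n + 1) * (real K - 1))"
      using True D M by (intro mult_left_mono) auto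
    finally show ?thesis .
  next
    case False
    define m where "m = n - K"
    have n: "n = m + K" using False by (simp add: m_def)
    have IH: "(\<Sum>s<m. l (s + 2) * h (s + 1)) \<le> D * M / 2 * (real (m + 1) * (real K - 1))"
      using K by (intro less.IH less.prems) (auto simp: n)
    have "(\<Sum>k<K. l (m + 2 + k) * h (m + 1 + k))
        \<le> l (m + 2) * (\<Sum>k<K. h (m + 1 + k)) + D * M * (\<Sum>k<K. real (k + 0))"
    proof (rule weighted_drift_bound)
      show "\<bar>l (m + 2 + k) - l (m + 2)\<bar> \<le> real (k + 0) * D" for k
        using drift_from_start[where l = l, OF drift, of "m + 2" k] by simp
    qed (simp add: h)
    also have "l (m + 2) * (\<Sum>k<K. h (m + 1 + k)) \<le> 0"
      using l0[of "m + 2"] less.prems[of "m + 1"] by (intro mult_nonneg_nonpos) (auto simp: n)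
    finally have win: "(\<Sum>k<K. l (m + 2 + k) * h (m + 1 + k)) \<le> D * M / 2 * (real K * (real K - 1))"
      by (simp add: gauss)
    have "(\<Sum>s<n. l (s + 2) * h (s + 1))
        = (\<Sum>s<m. l (s + 2) * h (s + 1)) + (\<Sum>k<K. l (m + 2 + k) * h (m + 1 + k))"
      unfolding n by (induction K) (auto simp: add_ac)
    with IH win show ?thesis by (simp add: n algebra_simps)
  qed
qed

section \<open>The regret bound\<close>

lemma lagrangian_linear:
  "lagrangian S b Q l =
     expect S Q (\<lambda>a. reservation_cost S a + l * (violation_cost S a b + transfer_cost S a b))
     + - l * threshold S"
  by (simp add: lagrangian_def expected_load_cost_def expect_def algebra_simps sum.distrib
      sum_distrib_left)

lemma cost_nonneg:
  assumes "network_model S"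
  shows "0 \<le> reservation_cost S a" "0 \<le> violation_cost S a c" "0 \<le> transfer_cost S a c"
  using assms
  by (auto simp: network_model_def reservation_cost_def violation_cost_def transfer_cost_def
      plan_violation_cost_def plan_transfer_cost_def intro!: sum_nonneg)

lemma slot_regret:
  assumes run: "saddle_point_run S \<alpha> \<mu> b P lam" and t: "1 \<le> t" and Q: "Q \<in> distributions S"
    and \<alpha>: "0 < \<alpha>"
  shows "expect S (P t) (reservation_cost S) - expect S Q (reservation_cost S)
      \<le> lam t * (expected_load_cost S Q (b (t - 1)) - threshold S)
        - lam t * (expected_load_cost S (P t) (b (t - 1)) - threshold S)
        + 1 / (2 * \<alpha>) * (L2_set (\<lambda>a. Q a - P (t - 1) a) (reservations S))\<^sup>2
        - 1 / (2 * \<alpha>) * (L2_set (\<lambda>a. Q a - P t a) (reservations S))\<^sup>2"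
proof -
  let ?f = "\<lambda>Q. expect S Q (\<lambda>a. reservation_cost S a
      + lam t * (violation_cost S a (b (t - 1)) + transfer_cost S a (b (t - 1))))"
  have "is_arg_min (\<lambda>Q. ?f Q + - lam t * threshold S
      + 1 / (2 * \<alpha>) * (L2_set (\<lambda>a. Q a - P (t - 1) a) (reservations S))\<^sup>2)
      (\<lambda>Q. Q \<in> distributions S) (P t)"
    using run t unfolding saddle_point_run_def lagrangian_linear by blast
  note prox = proximal_step[OF this Q]
  have f: "?f R = lagrangian S (b (t - 1)) R (lam t) + lam t * threshold S" for R
    by (simp add: lagrangian_linear)
  have "0 \<le> 1 / (2 * \<alpha>) * (L2_set (\<lambda>a. P t a - P (t - 1) a) (reservations S))\<^sup>2"
    using \<alpha> by simp
  with prox show ?thesis unfolding f lagrangian_def by (simp add: algebra_simps)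
qed

theorem theoremV2:
  fixes S :: network
    and \<Theta> \<eta> \<alpha> \<mu> :: real
    and E :: "(reservation \<Rightarrow> real) set"
    and Pslater Pstar :: "reservation \<Rightarrow> real"
    and b :: "nat \<Rightarrow> reservation"
    and P :: "nat \<Rightarrow> reservation \<Rightarrow> real"
    and lam :: "nat \<Rightarrow> real"
    and K T :: nat
  assumes "network_model S"
    and "0 < \<Theta>"
    and "\<And>a. a \<in> reservations S \<Longrightarrow> \<bar>reservation_cost S a\<bar> \<le> \<Theta>"
    and "\<And>a c. a \<in> reservations S \<Longrightarrow> c \<in> reservations S \<Longrightarrow> \<bar>transfer_cost S a c\<bar> \<le> \<Theta>"
    and "\<And>a c. a \<in> reservations S \<Longrightarrow> c \<in> reservations S \<Longrightarrow> \<bar>violation_cost S a c\<bar> \<le> \<Theta>"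
    and "E \<subseteq> distributions S"
    and "\<And>Q c. Q \<in> E \<Longrightarrow> c \<in> reservations S \<Longrightarrow> expected_load_cost S Q c - threshold S \<le> 0"
    and "Pslater \<in> E"
    and "0 < \<eta>"
    and "\<And>c. c \<in> reservations S \<Longrightarrow> expected_load_cost S Pslater c - threshold S \<le> - \<eta>"
    and "0 < \<alpha>"
    and "0 < \<mu>"
    and "saddle_point_run S \<alpha> \<mu> b P lam"
    and "lam 1 = 0"
    and "1 \<le> K"
    and "K \<le> T"
    and "benchmark_optimal S b K T Pstar"
  shows "regret S T P Pstar \<le>
      \<mu> * (2 * \<Theta> + threshold S)\<^sup>2 * ((real K - 1) * (2 * real K - 1) / 6)
      + (real T - real K)
        * (1 / 2 * real K * (4 * \<Theta>\<^sup>2 + (threshold S)\<^sup>2) * \<mu> + \<Theta>\<^sup>2 / 4 * \<alpha>)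
      + real K * (real K - 1) * \<Theta> + 1 / \<alpha>"
proof -
  note model = assms(1) and resb = assms(3) and trab = assms(4) and viob = assms(5)
    and \<alpha> = \<open>0 < \<alpha>\<close> and \<mu> = \<open>0 < \<mu>\<close> and \<Theta> = \<open>0 < \<Theta>\<close>
    and run = \<open>saddle_point_run S \<alpha> \<mu> b P lam\<close> and K = \<open>1 \<le> K\<close> and KT = \<open>K \<le> T\<close>
  define v where "v = threshold S"
  define U where "U = max 0 (2 * \<Theta> - v)"
  define M where "M = max U v"
  define r where "r Q = expect S Q (reservation_cost S)" for Q
  define c where "c Q t = expected_load_cost S Q (b t) - v" for Q t
  define dist2 where "dist2 t = (L2_set (\<lambda>a. Pstar a - P t a) (reservations S))\<^sup>2 / (2 * \<alpha>)" for t
  define n where "n = T - K"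
  have T: "T = n + K" using KT by (simp add: n_def)
  have v: "0 < v" using model by (simp add: v_def network_model_def)
  have U: "0 \<le> U" and M: "0 \<le> M" using v by (auto simp: U_def M_def)
  have b: "b t \<in> reservations S" for t
    using run by (simp add: saddle_point_run_def)
  have rec: "lam (t + 1) = max 0 (lam t + \<mu> * c (P t) (t - 1))" if "1 \<le> t" for t
    using run that by (simp add: saddle_point_run_def c_def v_def)
  have lam0: "0 \<le> lam t" if "1 \<le> t" for t
    using multiplier_nonneg[where g = "\<lambda>t. c (P t) (t - 1)", OF \<open>lam 1 = 0\<close> rec that] .
  have Pd: "P t \<in> distributions S" for t
    using run by (cases t) (force simp: saddle_point_run_def is_arg_min_def)+
  have feas: "benchmark_feasible S b K T Pstar"
    using \<open>benchmark_optimal S b K T Pstar\<close> by (simp add: benchmark_optimal_def is_arg_min_def)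
  then have Sd: "Pstar \<in> distributions S" by (simp add: benchmark_feasible_def)

  have c_range: "- v \<le> c Q t" "c Q t \<le> U" if Q: "Q \<in> distributions S" for Q t
  proof -
    have "0 \<le> violation_cost S a (b t) + transfer_cost S a (b t)" for a
      using cost_nonneg[OF model] by simp
    moreover have "violation_cost S a (b t) + transfer_cost S a (b t) \<le> 2 * \<Theta>"
      if a: "a \<in> reservations S" for a
      using trab[OF a b[of t]] viob[OF a b[of t]] by linarith
    ultimately have "0 \<le> expected_load_cost S Q (b t)" "expected_load_cost S Q (b t) \<le> 2 * \<Theta>"
      unfolding expected_load_cost_def
      using expect_between[OF Q, of 0 _ "2 * \<Theta>"] by auto
    then show "- v \<le> c Q t" "c Q t \<le> U" by (auto simp: c_def U_def)
  qed
  have c_abs: "\<bar>c Q t\<bar> \<le> M" if Q: "Q \<in> distributions S" for Q t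
    using c_range[OF Q, of t] by (auto simp: M_def)
  have r_range: "0 \<le> r Q" "r Q \<le> \<Theta>" if Q: "Q \<in> distributions S" for Q
    unfolding r_def using expect_between[OF Q, of 0 "reservation_cost S" \<Theta>] resb
      cost_nonneg[OF model] by (auto simp: abs_le_iff)

  have window: "(\<Sum>k<K. c Pstar (t + k)) \<le> 0" if "1 \<le> t" "t + K \<le> n + 1" for t
  proof -
    have "t \<in> {1..T - K + 1}" using that K by (simp add: T)
    then have "(\<Sum>k = t..t + K - 1. expected_load_cost S Pstar (b k)) \<le> real K * v"
      using feas unfolding benchmark_feasible_def v_def by blast
    also have "{t..t + K - 1} = {0 + t..<K + t}" using K by auto
    finally show ?thesis
      unfolding sum.shift_bounds_nat_ivl
      by (simp add: c_def sum_subtractf add.commute lessThan_atLeast0)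
  qed

  have "(\<Sum>t = 1..n + 1. - lam t * c (P t) (t - 1)) \<le> real n * (\<mu> * (U\<^sup>2 + v\<^sup>2) / 2)"
    using multiplier_correlation[where g = "\<lambda>t. c (P t) (t - 1)" and v = v and U = U and n = n,
        OF \<open>lam 1 = 0\<close> rec \<mu>] c_range[OF Pd] U v by simp
  moreover
  \<comment> \<open>Slot \<open>t\<close> uses the request \<open>b (t - 1)\<close>. The request \<open>b 0\<close>, which lies in no benchmark window,
    is met with the multiplier \<open>lam 1 = 0\<close>.\<close>
  have "(\<Sum>t = 1..n + 1. lam t * c Pstar (t - 1)) = (\<Sum>s<n. lam (s + 2) * c Pstar (s + 1))"
    using \<open>lam 1 = 0\<close> by (induction n) auto
  moreover have "(\<Sum>s<n. lam (s + 2) * c Pstar (s + 1))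
      \<le> \<mu> * M * M / 2 * (real (n + 1) * (real K - 1))"
  proof (rule windowed_correlation[where l = lam, OF \<open>lam 1 = 0\<close> lam0 _ _ _ M K window])
    show "\<bar>lam (t + 1) - lam t\<bar> \<le> \<mu> * M" if "1 \<le> t" for t
      using multiplier_step[where g = "\<lambda>t. c (P t) (t - 1)", OF rec[OF that] lam0[OF that]]
        \<mu> c_abs[OF Pd] by simp
  qed (use c_abs[OF Sd] \<mu> M in auto)
  moreover have "(\<Sum>t = 1..n + 1. dist2 (t - 1) - dist2 t) \<le> 1 / \<alpha>"
  proof -
    have "(\<Sum>t = 1..n + 1. dist2 (t - 1) - dist2 t) = dist2 0 - dist2 (n + 1)"
      by (induction n) auto
    also have "\<dots> \<le> dist2 0" using \<alpha> by (simp add: dist2_def)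
    also have "\<dots> \<le> 2 / (2 * \<alpha>)"
      unfolding dist2_def using distributions_diameter[OF Sd Pd[of 0]] \<alpha>
      by (intro divide_right_mono) auto
    finally show ?thesis by simp
  qed
  moreover have "(\<Sum>t = 1..n + 1. r (P t) - r Pstar)
      \<le> (\<Sum>t = 1..n + 1. lam t * c Pstar (t - 1) + - lam t * c (P t) (t - 1)
            + (dist2 (t - 1) - dist2 t))"
  proof (rule sum_mono)
    fix t assume "t \<in> {1..n + 1}"
    then show "r (P t) - r Pstar \<le> lam t * c Pstar (t - 1) + - lam t * c (P t) (t - 1)
        + (dist2 (t - 1) - dist2 t)"
      using slot_regret[OF run _ Sd \<alpha>, of t] by (simp add: r_def c_def v_def dist2_def)
  qed
  ultimately have early: "(\<Sum>t = 1..n + 1. r (P t) - r Pstar)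
      \<le> \<mu> * M * M / 2 * (real (n + 1) * (real K - 1)) + real n * (\<mu> * (U\<^sup>2 + v\<^sup>2) / 2) + 1 / \<alpha>"
    unfolding sum.distrib by linarith

  have late: "(\<Sum>t = n + 2..T. r (P t) - r Pstar) \<le> (real K - 1) * \<Theta>"
  proof -
    have "(\<Sum>t = n + 2..T. r (P t) - r Pstar) \<le> (\<Sum>t = n + 2..T. \<Theta>)"
      using r_range(2)[OF Pd] r_range(1)[OF Sd] by (intro sum_mono) (smt (verit))
    also have "\<dots> = (real K - 1) * \<Theta>" using K by (simp add: T of_nat_diff)
    finally show ?thesis .
  qed
  have "regret S T P Pstar = (\<Sum>t = 1..n + 1. r (P t) - r Pstar) + (\<Sum>t = n + 2..T. r (P t) - r Pstar)"
    using sum.ub_add_nat[of 1 "n + 1" "\<lambda>t. r (P t) - r Pstar" "K - 1"] K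
    by (simp add: regret_def r_def T)
  also have "\<dots> \<le> \<mu> * M * M / 2 * (real (n + 1) * (real K - 1)) + real n * (\<mu> * (U\<^sup>2 + v\<^sup>2) / 2)
      + 1 / \<alpha> + (real K - 1) * \<Theta>"
    using early late by linarith
  finally have reg: "regret S T P Pstar \<le> \<mu> * M * M / 2 * (real (n + 1) * (real K - 1))
      + real n * (\<mu> * (U\<^sup>2 + v\<^sup>2) / 2) + 1 / \<alpha> + (real K - 1) * \<Theta>" .

  define G where "G = 4 * \<Theta>\<^sup>2 + v\<^sup>2"
  have G0: "0 \<le> G" by (simp add: G_def)
  have UG: "U\<^sup>2 + v\<^sup>2 \<le> G"
  proof -
    have "U\<^sup>2 \<le> (2 * \<Theta>)\<^sup>2" using v \<Theta> U by (intro power_mono) (auto simp: U_def)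
    then show ?thesis by (simp add: G_def power_mult_distrib)
  qed
  have MG: "M * M \<le> G" using UG by (auto simp: M_def max_def power2_eq_square intro: order_trans[rotated])
  have Gv: "G \<le> (2 * \<Theta> + v)\<^sup>2" using v \<Theta> by (simp add: G_def power2_eq_square algebra_simps)
  have K1: "0 \<le> real K - 1" using K by simp
  have "\<mu> * M * M / 2 * (real (n + 1) * (real K - 1)) \<le> \<mu> * G / 2 * (real (n + 1) * (real K - 1))"
    using MG \<mu> K1 by (intro mult_right_mono) (auto simp: mult.assoc)
  moreover have "real n * (\<mu> * (U\<^sup>2 + v\<^sup>2) / 2) \<le> real n * (\<mu> * G / 2)"
    using UG \<mu> by (intro mult_left_mono divide_right_mono) auto
  moreover have "\<mu> * G / 2 * (real K - 1)
      \<le> \<mu> * (2 * \<Theta> + v)\<^sup>2 * ((real K - 1) * (2 * real K - 1) / 6)"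
  proof -
    \<comment> \<open>This is an equality for \<open>K = 1\<close>; for \<open>K \<ge> 2\<close> the last factor is at least \<open>3\<close>.\<close>
    have "(real K - 1) * 3 \<le> (real K - 1) * (2 * real K - 1)"
      using K by (cases "K = 1") (auto intro: mult_left_mono simp del: left_diff_distrib_numeral)
    then have "\<mu> * G * ((real K - 1) / 2) \<le> \<mu> * (2 * \<Theta> + v)\<^sup>2 * ((real K - 1) * (2 * real K - 1) / 6)"
      using Gv \<mu> G0 K1 by (intro mult_mono) auto
    then show ?thesis by simp
  qed
  moreover have "(real K - 1) * \<Theta> \<le> real K * (real K - 1) * \<Theta>"
    using K \<Theta> by (intro mult_right_mono mult_right_mono[of 1 "real K", simplified]) auto
  moreover have "0 \<le> real n * (\<Theta>\<^sup>2 / 4 * \<alpha>)" using \<alpha> by simp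
  moreover have "\<mu> * G / 2 * (real (n + 1) * (real K - 1)) + real n * (\<mu> * G / 2)
      = real n * (1 / 2 * real K * G * \<mu>) + \<mu> * G / 2 * (real K - 1)"
    by (simp add: field_simps)
  ultimately have "regret S T P Pstar \<le> \<mu> * (2 * \<Theta> + v)\<^sup>2 * ((real K - 1) * (2 * real K - 1) / 6)
      + (real n * (1 / 2 * real K * G * \<mu>) + real n * (\<Theta>\<^sup>2 / 4 * \<alpha>))
      + real K * (real K - 1) * \<Theta> + 1 / \<alpha>"
    using reg by linarith
  moreover have "real T - real K = real n" by (simp add: T)
  ultimately show ?thesis
    by (simp add: G_def v_def distrib_left)
qed

end
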